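(* Let $a_1,a_2,b_1,b_2,\lambda$ be indeterminates and define the array $[T_{n,k}]_{n,k\geq 0}$ of polynomials in $\mathbb{R}[a_1,a_2,b_1,b_2,\lambda]$ by $T_{0,0}=1$, $T_{n,k}=0$ unless $0\le k\le n$, and for $n\geq 1$ $$T_{n,k}=(b_1k+b_2)T_{n-1,k-1}+[(2\lambda b_1+a_1)k+a_2+\lambda(b_1+b_2)]T_{n-1,k}+\lambda(a_1+\lambda b_1)(k+1)T_{n-1,k+1}.$$ Then the infinite lower triangular matrix $[T_{n,k}]_{n,k\geq0}$ is $\mathbf{x}$-totally positive with $\mathbf{x}=(a_1,a_2,b_1,b_2,\lambda)$.
   Context: A matrix whose entries are polynomials in a set of indeterminates $\mathbf{x}$ is called $\mathbf{x}$-totally positive ($\mathbf{x}$-TP) if every minor of it (of every finite order) is a polynomial with nonnegative coefficients in the indeterminates $\mathbf{x}$. *)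

theory Defs
  imports "HOL-Library.Poly_Mapping" "Jordan_Normal_Form.Determinant"
begin

text \<open>
  Multivariate polynomials with real coefficients in indeterminates \<open>'x\<close> are rendered as the
  monoid algebra of the exponent vectors \<open>'x \<Rightarrow>\<^sub>0 nat\<close>: \<open>Poly_Mapping.lookup p m\<close> is the
  coefficient in \<open>p\<close> of the monomial with exponent vector \<open>m\<close>, and multiplication is convolution.
\<close>

type_synonym 'x real_mpoly = "('x \<Rightarrow>\<^sub>0 nat) \<Rightarrow>\<^sub>0 real"

definition indet :: "'x \<Rightarrow> 'x real_mpoly" where
  "indet x = Poly_Mapping.single (Poly_Mapping.single x 1) 1"

definition nonneg_coeffs :: "'x real_mpoly \<Rightarrow> bool" where
  "nonneg_coeffs p \<longleftrightarrow> (\<forall>m. 0 \<le> Poly_Mapping.lookup p m)"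

definition minor :: "(nat \<Rightarrow> nat \<Rightarrow> 'a::comm_ring_1) \<Rightarrow> nat \<Rightarrow> (nat \<Rightarrow> nat) \<Rightarrow> (nat \<Rightarrow> nat) \<Rightarrow> 'a" where
  "minor M r I J = det (mat r r (\<lambda>(i, j). M (I i) (J j)))"

text \<open>
  The row set and the column set of a minor of order \<open>r\<close> are given by their increasing
  enumerations \<open>I\<close> and \<open>J\<close>, of which only the values on \<open>{..<r}\<close> matter.  The order \<open>r = 0\<close>
  is included; it only contributes the empty determinant 1.
\<close>

definition coefficientwise_TP :: "(nat \<Rightarrow> nat \<Rightarrow> 'x real_mpoly) \<Rightarrow> bool" where
  "coefficientwise_TP M \<longleftrightarrow>
     (\<forall>r I J. strict_mono_on {..<r} I \<longrightarrow> strict_mono_on {..<r} J \<longrightarrow> nonneg_coeffs (minor M r I J))"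

datatype var = A1 | A2 | B1 | B2 | Lam

abbreviation a1 :: "var real_mpoly" where "a1 \<equiv> indet A1"
abbreviation a2 :: "var real_mpoly" where "a2 \<equiv> indet A2"
abbreviation b1 :: "var real_mpoly" where "b1 \<equiv> indet B1"
abbreviation b2 :: "var real_mpoly" where "b2 \<equiv> indet B2"
abbreviation lam :: "var real_mpoly" where "lam \<equiv> indet Lam"

text \<open>
  The entry with column index \<open>-1\<close> is zero; as \<open>k - 1\<close> is truncated on \<open>nat\<close>, the case
  \<open>k = 0\<close> is singled out.
\<close>

fun T :: "nat \<Rightarrow> nat \<Rightarrow> var real_mpoly" where
  "T 0 k = (if k = 0 then 1 else 0)"
| "T (Suc n) k =
     (if k > Suc n then 0
      else (b1 * of_nat k + b2) * (if k = 0 then 0 else T n (k - 1))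
         + ((2 * lam * b1 + a1) * of_nat k + a2 + lam * (b1 + b2)) * T n k
         + lam * (a1 + lam * b1) * of_nat (k + 1) * T n (k + 1))"

end

theory Submission
  imports Defs
begin

text \<open>
  The row polynomials satisfy \<open>T\<^sub>n(x) = S\<^sub>n(x + \<lambda>)\<close>, where
  \<open>S\<^sub>n\<^sub>,\<^sub>k = (a\<^sub>1 k + a\<^sub>2) S\<^sub>n\<^sub>-\<^sub>1\<^sub>,\<^sub>k + (b\<^sub>1 k + b\<^sub>2) S\<^sub>n\<^sub>-\<^sub>1\<^sub>,\<^sub>k\<^sub>-\<^sub>1\<close>; that is, \<open>T\<close> is the
  product of \<open>S\<close> with the weighted Pascal matrix \<open>(j choose k) \<lambda>\<^bsup>j-k\<^esup>\<close>.  Both factors arise from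
  multiplications by bidiagonal matrices with nonnegative entries: the rows of \<open>S\<close> other than
  the first form \<open>S\<close> times its bidiagonal production matrix, and every finite section of the
  Pascal matrix is a product of bidiagonal matrices.  Multiplication by a bidiagonal matrix
  preserves total positivity, because expanding a minor by multilinearity one column at a time
  only produces minors with increasing columns or with two equal columns.
\<close>

section \<open>Closure properties of polynomials with nonnegative coefficients\<close>

lemma nonneg_coeffs_0 [simp]: "nonneg_coeffs 0"
  by (simp add: nonneg_coeffs_def)

lemma nonneg_coeffs_1 [simp]: "nonneg_coeffs 1"
  by (auto simp: nonneg_coeffs_def lookup_one when_def)

lemma nonneg_coeffs_add [simp]:
  "nonneg_coeffs p \<Longrightarrow> nonneg_coeffs q \<Longrightarrow> nonneg_coeffs (p + q)"
  by (simp add: nonneg_coeffs_def lookup_add)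

lemma Sum_any_nonneg:
  fixes f :: "'b \<Rightarrow> 'c::ordered_comm_monoid_add"
  assumes "\<And>x. 0 \<le> f x"
  shows "0 \<le> Sum_any f"
  using assms by (simp add: Sum_any.expand_set sum_nonneg)

lemma nonneg_coeffs_mult [simp]:
  assumes "nonneg_coeffs p" "nonneg_coeffs q"
  shows "nonneg_coeffs (p * q)"
  unfolding nonneg_coeffs_def
proof
  fix m
  have "0 \<le> (Poly_Mapping.lookup q u when P)" for u P
    using assms(2) by (simp add: nonneg_coeffs_def when_def)
  then show "0 \<le> Poly_Mapping.lookup (p * q) m"
    using assms(1) unfolding lookup_mult nonneg_coeffs_def
    by (intro Sum_any_nonneg mult_nonneg_nonneg) auto
qed

lemma nonneg_coeffs_of_nat [simp]: "nonneg_coeffs (of_nat n)"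
  by (induction n) auto

lemma nonneg_coeffs_indet [simp]: "nonneg_coeffs (indet x)"
  by (auto simp: nonneg_coeffs_def indet_def lookup_single when_def)

section \<open>Minors and column operations\<close>

lemma mat_delete_cong_column:
  assumes "A \<in> carrier_mat r r" "B \<in> carrier_mat r r" "s < r"
    and "\<And>i j. i < r \<Longrightarrow> j < r \<Longrightarrow> j \<noteq> s \<Longrightarrow> A $$ (i, j) = B $$ (i, j)"
  shows "mat_delete A i s = mat_delete B i s"
  using assms by (intro eq_matI) (auto simp: mat_delete_def)

text \<open>The cofactors along column \<open>s\<close> do not involve that column, so Laplace
  expansion along it is linear in its entries.\<close>

lemma det_column_linear:
  fixes A :: "'a::comm_ring_1 mat"
  assumes A: "A \<in> carrier_mat r r" and B: "B \<in> carrier_mat r r" and C: "C \<in> carrier_mat r r"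
    and s: "s < r"
    and eqB: "\<And>i j. i < r \<Longrightarrow> j < r \<Longrightarrow> j \<noteq> s \<Longrightarrow> A $$ (i, j) = B $$ (i, j)"
    and eqC: "\<And>i j. i < r \<Longrightarrow> j < r \<Longrightarrow> j \<noteq> s \<Longrightarrow> A $$ (i, j) = C $$ (i, j)"
    and col: "\<And>i. i < r \<Longrightarrow> A $$ (i, s) = p * B $$ (i, s) + q * C $$ (i, s)"
  shows "det A = p * det B + q * det C"
proof -
  have dB: "cofactor A i s = cofactor B i s" for i
    unfolding cofactor_def using mat_delete_cong_column[OF A B s eqB] by simp
  have dC: "cofactor A i s = cofactor C i s" for i
    unfolding cofactor_def using mat_delete_cong_column[OF A C s eqC] by simp
  have "det A = (\<Sum>i<r. A $$ (i, s) * cofactor A i s)"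
    by (rule laplace_expansion_column[OF A s])
  also have "\<dots> = (\<Sum>i<r. p * (B $$ (i, s) * cofactor B i s) + q * (C $$ (i, s) * cofactor C i s))"
    by (intro sum.cong refl) (simp add: col dB[symmetric] dC[symmetric] algebra_simps)
  also have "\<dots> = p * det B + q * det C"
    by (simp add: sum.distrib sum_distrib_left
        laplace_expansion_column[OF B s] laplace_expansion_column[OF C s])
  finally show ?thesis .
qed

lemma minor_zero_column:
  assumes "s < r" "\<And>i. i < r \<Longrightarrow> M (I i) (J s) = 0"
  shows "minor M r I J = 0"
  unfolding minor_def
  by (subst laplace_expansion_column[of _ r s]) (use assms in auto)

lemma minor_cong:
  assumes "\<And>i j. i < r \<Longrightarrow> j < r \<Longrightarrow> M (I i) (J j) = M' (I' i) (J' j)"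
  shows "minor M r I J = minor M' r I' J'"
proof -
  have "mat r r (\<lambda>(i, j). M (I i) (J j)) = mat r r (\<lambda>(i, j). M' (I' i) (J' j))"
    using assms by (intro eq_matI) auto
  then show ?thesis by (simp add: minor_def)
qed

text \<open>The row set \<open>I\<close> stays fixed throughout, so nonnegativity is required only
  for minors on these rows; this allows use inside an induction over row indices.\<close>

lemma nonneg_minor_bidiagonal:
  fixes M :: "nat \<Rightarrow> nat \<Rightarrow> 'x real_mpoly"
  assumes M: "\<And>J. strict_mono_on {..<r} J \<Longrightarrow> nonneg_coeffs (minor M r I J)"
    and p: "\<And>k. nonneg_coeffs (p k)" and q: "\<And>k. nonneg_coeffs (q k)"
    and J: "strict_mono_on {..<r} J"
  shows "nonneg_coeffs (minor (\<lambda>n k. p k * M n k + q k * M n (Suc k)) r I J)"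
proof -
  define M' where "M' n k = p k * M n k + q k * M n (Suc k)" for n k
  \<comment> \<open>Columns are combined from left to right: when column \<open>s\<close> is split,
    those to its right are still plain columns of \<open>M\<close>, so a shifted index can only
    collide with column \<open>Suc s\<close>.\<close>
  define D where
    "D s J = mat r r (\<lambda>(i, j). if j < s then M' (I i) (J j) else M (I i) (J j))"
    for s and J :: "nat \<Rightarrow> nat"
  have D: "D s J \<in> carrier_mat r r" for s J by (simp add: D_def)
  have "nonneg_coeffs (det (D s J))" if "s \<le> r" "strict_mono_on {..<r} J" for s J
    using that
  proof (induction s arbitrary: J)
    case 0
    then show ?case using M[of J] by (simp add: D_def minor_def)
  next
    case (Suc s)
    let ?J = "J(s := Suc (J s))"
    have s: "s < r" using Suc.prems by simp
    have J: "J i < J j" if "i < j" "j < r" for i j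
      using Suc.prems(2) that by (auto simp: strict_mono_on_def)
    have split: "det (D (Suc s) J) = p (J s) * det (D s J) + q (J s) * det (D s ?J)"
      by (rule det_column_linear[OF D D D s]) (use s in \<open>auto simp: D_def M'_def\<close>)
    have "nonneg_coeffs (det (D s ?J))"
    proof (cases "Suc s < r \<and> J (Suc s) = Suc (J s)")
      case True
      have "det (D s ?J) = 0"
        by (rule det_identical_columns[OF D, of s "Suc s"])
          (use True in \<open>auto simp: D_def intro!: eq_vecI\<close>)
      then show ?thesis by simp
    next
      case False
      have "strict_mono_on {..<r} ?J"
      proof (rule strict_mono_onI)
        fix i j assume ij: "i \<in> {..<r}" "j \<in> {..<r}" "i < j"
        have *: "Suc (J s) < J j" if "i = s"
        proof (cases "j = Suc s")
          case True
          then show ?thesis using False J[of s "Suc s"] ij by auto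
        next
          case False
          then show ?thesis using J[of s "Suc s"] J[of "Suc s" j] ij that by auto
        qed
        show "?J i < ?J j"
          using * J[OF \<open>i < j\<close>] ij by auto
      qed
      then show ?thesis using Suc s by simp
    qed
    then show ?case
      unfolding split using Suc s p q by simp
  qed
  from this[OF order_refl J] show ?thesis
    unfolding minor_def D_def M'_def
    by (rule back_subst[of nonneg_coeffs], intro arg_cong[of _ _ det] eq_matI) auto
qed

section \<open>Total positivity of arrays with a two-term recurrence\<close>

fun two_term_array ::
    "(nat \<Rightarrow> 'a::comm_semiring_1) \<Rightarrow> (nat \<Rightarrow> 'a) \<Rightarrow> nat \<Rightarrow> nat \<Rightarrow> 'a" where
  "two_term_array a b 0 k = (if k = 0 then 1 else 0)"
| "two_term_array a b (Suc n) k =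
     a k * two_term_array a b n k + (if k = 0 then 0 else b k * two_term_array a b n (k - 1))"

lemma two_term_array_eq_0: "n < k \<Longrightarrow> two_term_array a b n k = 0"
  by (induction n arbitrary: k) auto

text \<open>Induction on a bound for the row indices: a minor avoiding row 0 is a minor of a
  bidiagonal product on rows lowered by one, and row 0, being a unit vector, can be split
  off.\<close>

lemma coefficientwise_TP_two_term_array:
  fixes a b :: "nat \<Rightarrow> 'x real_mpoly"
  assumes a: "\<And>k. nonneg_coeffs (a k)" and b: "\<And>k. nonneg_coeffs (b k)"
  shows "coefficientwise_TP (two_term_array a b)"
proof -
  define S where "S = two_term_array a b"
  have bounded: "nonneg_coeffs (minor S r I J)"
    if "strict_mono_on {..<r} I" "strict_mono_on {..<r} J" "\<forall>i<r. I i < N" for N r I J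
    using that
  proof (induction N arbitrary: r I J)
    case 0
    then show ?case by (cases r) (auto simp: minor_def)
  next
    case (Suc N)
    have pos: "nonneg_coeffs (minor S r I J)"
      if I: "strict_mono_on {..<r} I" and J: "strict_mono_on {..<r} J"
        and bd: "\<forall>i<r. 0 < I i \<and> I i < Suc N" for r I J
    proof -
      \<comment> \<open>Prepending a zero column turns the columns \<open>k - 1\<close> and \<open>k\<close> into \<open>k\<close> and \<open>k + 1\<close>.\<close>
      define Z where "Z n k = (if k = 0 then 0 else S n (k - 1))" for n k
      define I' where "I' i = I i - 1" for i
      have I': "strict_mono_on {..<r} I'"
        using I bd by (fastforce simp: strict_mono_on_def I'_def)
      have "nonneg_coeffs (minor Z r I' K)" if K: "strict_mono_on {..<r} K" for K
      proof (cases "\<exists>s<r. K s = 0")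
        case True
        then show ?thesis using minor_zero_column[of _ r Z I' K] by (auto simp: Z_def)
      next
        case False
        have "minor Z r I' K = minor S r I' (\<lambda>j. K j - 1)"
          using False by (intro minor_cong) (auto simp: Z_def)
        moreover have "strict_mono_on {..<r} (\<lambda>j. K j - 1)"
          using K False by (fastforce simp: strict_mono_on_def)
        moreover have "\<forall>i<r. I' i < N" using bd by (fastforce simp: I'_def)
        ultimately show ?thesis using Suc.IH I' by simp
      qed
      then have "nonneg_coeffs (minor (\<lambda>n k. b k * Z n k + a k * Z n (Suc k)) r I' J)"
        using a b J by (intro nonneg_minor_bidiagonal)
      also have "minor (\<lambda>n k. b k * Z n k + a k * Z n (Suc k)) r I' J = minor S r I J"
      proof (rule minor_cong)
        fix i j assume "i < r" "j < r"
        then have "I i = Suc (I' i)" using bd by (simp add: I'_def)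
        then show "b (J j) * Z (I' i) (J j) + a (J j) * Z (I' i) (Suc (J j)) = S (I i) (J j)"
          by (simp add: S_def Z_def add.commute)
      qed
      finally show ?thesis .
    qed
    have I: "I i < I j" if "i < j" "j < r" for i j
      using Suc.prems(1) that by (auto simp: strict_mono_on_def)
    have J: "J i < J j" if "i < j" "j < r" for i j
      using Suc.prems(2) that by (auto simp: strict_mono_on_def)
    show ?case
    proof (cases "r > 0 \<and> I 0 = 0")
      case False
      have "0 < I i" if "i < r" for i
        using False I[of 0 i] that by (cases i) auto
      then show ?thesis using pos Suc.prems by blast
    next
      case True
      then obtain r' where r: "r = Suc r'" by (cases r) auto
      let ?A = "mat r r (\<lambda>(i, j). S (I i) (J j))"
      \<comment> \<open>Only the first chosen column can have index 0, so the expansion along row 0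
        of \<open>S\<close> keeps at most its corner term.\<close>
      have J0: "J (Suc j) \<noteq> 0" if "j < r'" for j
        using J[of 0 "Suc j"] that r by simp
      have "minor S r I J = (\<Sum>j<r. ?A $$ (0, j) * cofactor ?A 0 j)"
        unfolding minor_def by (rule laplace_expansion_row) (simp_all add: r)
      also have "\<dots> = ?A $$ (0, 0) * cofactor ?A 0 0 + (\<Sum>j<r'. ?A $$ (0, Suc j) * cofactor ?A 0 (Suc j))"
        unfolding r by (rule sum.lessThan_Suc_shift)
      also have "(\<Sum>j<r'. ?A $$ (0, Suc j) * cofactor ?A 0 (Suc j)) = 0"
        using True by (intro sum.neutral ballI) (simp add: S_def r J0)
      also have "mat_delete ?A 0 0 = mat r' r' (\<lambda>(i, j). S (I (Suc i)) (J (Suc j)))"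
        by (intro eq_matI) (auto simp: mat_delete_def r)
      then have "cofactor ?A 0 0 = minor S r' (I \<circ> Suc) (J \<circ> Suc)"
        by (simp add: cofactor_def minor_def)
      finally have "minor S r I J = S 0 (J 0) * minor S r' (I \<circ> Suc) (J \<circ> Suc)"
        using True by simp
      moreover have "nonneg_coeffs (minor S r' (I \<circ> Suc) (J \<circ> Suc))"
      proof (rule pos)
        show "strict_mono_on {..<r'} (I \<circ> Suc)" "strict_mono_on {..<r'} (J \<circ> Suc)"
          using I J by (auto simp: strict_mono_on_def r)
        show "\<forall>i<r'. 0 < (I \<circ> Suc) i \<and> (I \<circ> Suc) i < Suc N"
          using I[of 0 "Suc _"] Suc.prems(3) by (fastforce simp: r)
      qed
      ultimately show ?thesis by (simp add: S_def)
    qed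
  qed
  show ?thesis
    unfolding coefficientwise_TP_def S_def[symmetric]
  proof (intro allI impI)
    fix r :: nat and I J :: "nat \<Rightarrow> nat"
    assume IJ: "strict_mono_on {..<r} I" "strict_mono_on {..<r} J"
    have "\<forall>i<r. I i < Suc (Max (I ` {..<r}))" by (auto simp: less_Suc_eq_le)
    then show "nonneg_coeffs (minor S r I J)" by (rule bounded[OF IJ])
  qed
qed

section \<open>The weighted Pascal matrix\<close>

definition pascal :: "'a::comm_semiring_1 \<Rightarrow> nat \<Rightarrow> nat \<Rightarrow> 'a" where
  "pascal x j k = of_nat (j choose k) * x ^ (j - k)"

lemma pascal_eq_0: "j < k \<Longrightarrow> pascal x j k = 0"
  by (simp add: pascal_def binomial_eq_0)

lemma pascal_Suc_0: "pascal x (Suc j) 0 = x * pascal x j 0"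
  by (simp add: pascal_def)

lemma pascal_Suc_Suc: "pascal x (Suc j) (Suc k) = pascal x j k + x * pascal x j (Suc k)"
proof (cases "Suc k \<le> j")
  case True
  then have "j - k = Suc (j - Suc k)" by simp
  then show ?thesis by (simp add: pascal_def algebra_simps)
qed (auto simp: pascal_def not_le less_Suc_eq_le binomial_eq_0)

text \<open>Binomial absorption, trading column \<open>k + 1\<close> for column \<open>k\<close>.
  The subtraction is taken in the ring, so that the identity also covers \<open>j < k\<close>, where
  both sides vanish.\<close>

lemma pascal_absorb:
  fixes x :: "'a::comm_ring_1"
  shows "of_nat (Suc k) * (x * pascal x j (Suc k)) = (of_nat j - of_nat k) * pascal x j k"
proof (cases "k < j")
  case True
  then have "j - k = Suc (j - Suc k)" by simp
  moreover have "of_nat (Suc k * (j choose Suc k)) = (of_nat ((j - k) * (j choose k)) :: 'a)"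
    by (metis binomial_absorb_comp binomial_absorption mult.commute)
  then have "of_nat (Suc k) * of_nat (j choose Suc k)
      = (of_nat j - of_nat k) * (of_nat (j choose k) :: 'a)"
    using True by (simp only: of_nat_mult of_nat_diff less_imp_le)
  moreover have "of_nat (Suc k) * (x * pascal x j (Suc k))
      = (of_nat (Suc k) * of_nat (j choose Suc k)) * x ^ Suc (j - Suc k)"
    by (simp add: pascal_def mult_ac)
  ultimately show ?thesis by (simp add: pascal_def mult.assoc del: of_nat_Suc power_Suc)
qed (cases "k = j"; simp add: pascal_def binomial_eq_0)

lemma coefficientwise_TP_times_pascal:
  fixes M :: "nat \<Rightarrow> nat \<Rightarrow> 'x real_mpoly"
  assumes M: "coefficientwise_TP M" and x: "nonneg_coeffs x"
    and lower: "\<And>n k. n < k \<Longrightarrow> M n k = 0"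
  shows "coefficientwise_TP (\<lambda>n k. \<Sum>j\<le>n. M n j * pascal x j k)"
proof -
  \<comment> \<open>\<open>R m\<close> is \<open>M\<close> times the block diagonal matrix of an identity of size \<open>m\<close> and the Pascal matrix.\<close>
  define R where
    "R m n k = (if k < m then M n k else \<Sum>j\<in>{m..n}. M n j * pascal x (j - m) (k - m))" for m n k
  \<comment> \<open>Pascal's rule, applied to the block starting at \<open>m\<close>, peels off one
    bidiagonal factor that fixes the columns before \<open>m\<close>.\<close>
  have step: "R m n k = 1 * R (Suc m) n k + (if k < m then 0 else x) * R (Suc m) n (Suc k)"
    for m n k
  proof -
    consider "k < m" | "m \<le> k" "n < m" | "m \<le> k" "m \<le> n" by linarith
    then show ?thesis
    proof cases
      case 3
      then have split: "{m..n} = insert m {Suc m..n}" by auto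
      have *: "j - m = Suc (j - Suc m)" if "j \<in> {Suc m..n}" for j using that by auto
      show ?thesis
      proof (cases "k = m")
        case True
        have "(\<Sum>j\<in>{Suc m..n}. M n j * pascal x (j - m) 0)
            = x * (\<Sum>j\<in>{Suc m..n}. M n j * pascal x (j - Suc m) 0)"
          unfolding sum_distrib_left
          by (intro sum.cong refl) (simp add: * pascal_Suc_0 mult_ac)
        then show ?thesis using True by (simp add: R_def split pascal_def)
      next
        case False
        then obtain l where l: "k - m = Suc l" "k - Suc m = l" "Suc k - Suc m = Suc l"
          using 3 by (cases "k - m") auto
        have "(\<Sum>j\<in>{Suc m..n}. M n j * pascal x (j - m) (Suc l))
            = (\<Sum>j\<in>{Suc m..n}. M n j * pascal x (j - Suc m) l)
              + x * (\<Sum>j\<in>{Suc m..n}. M n j * pascal x (j - Suc m) (Suc l))"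
          unfolding sum_distrib_left sum.distrib[symmetric]
          by (intro sum.cong refl) (simp add: * pascal_Suc_Suc algebra_simps)
        then show ?thesis using 3 False by (simp add: R_def l split pascal_eq_0)
      qed
    qed (auto simp: R_def lower)
  qed
  show ?thesis
    unfolding coefficientwise_TP_def
  proof (intro allI impI)
    fix r :: nat and I J :: "nat \<Rightarrow> nat"
    assume I: "strict_mono_on {..<r} I" and J: "strict_mono_on {..<r} J"
    \<comment> \<open>Beyond all chosen rows, the identity block covers every nonzero entry:
      \<open>R N\<close> agrees with \<open>M\<close> on these rows. Descending from
      \<open>N\<close> to 0 then takes finitely many bidiagonal steps.\<close>
    define N where "N = Suc (Max (I ` {..<r}))"
    have N: "I i < N" if "i < r" for i
      using that by (auto simp: N_def less_Suc_eq_le)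
    have "nonneg_coeffs (minor (R (N - d)) r I J)" if "d \<le> N" "strict_mono_on {..<r} J" for d J
      using that
    proof (induction d arbitrary: J)
      case 0
      have "minor (R N) r I J = minor M r I J"
        using less_le_trans[OF N] by (intro minor_cong) (auto simp: R_def not_less lower)
      then show ?case using M I 0 by (simp add: coefficientwise_TP_def)
    next
      case (Suc d)
      let ?m = "N - Suc d"
      have m: "Suc ?m = N - d" using Suc.prems by simp
      have "nonneg_coeffs (minor (\<lambda>n k. 1 * R (Suc ?m) n k
          + (if k < ?m then 0 else x) * R (Suc ?m) n (Suc k)) r I J)"
        by (rule nonneg_minor_bidiagonal) (use Suc x m in auto)
      then show ?case by (simp only: step[symmetric])
    qed
    from this[of N J] have "nonneg_coeffs (minor (R 0) r I J)" using J by simp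
    also have "R 0 = (\<lambda>n k. \<Sum>j\<le>n. M n j * pascal x j k)"
      by (intro ext) (simp add: R_def atMost_atLeast0)
    finally show "nonneg_coeffs (minor (\<lambda>n k. \<Sum>j\<le>n. M n j * pascal x j k) r I J)" .
  qed
qed

section \<open>Factorization of \<open>T\<close>\<close>

lemma T_eq_0: "n < k \<Longrightarrow> T n k = 0"
  by (cases n) auto

text \<open>Entry \<open>(j, k)\<close> of a matrix identity: the bidiagonal production matrix of
  the two-term array times Pascal equals Pascal times the tridiagonal production matrix of
  \<open>T\<close>, with \<open>x\<close> in the place of \<open>lam\<close>.\<close>

lemma pascal_intertwines:
  fixes a1 a2 b1 b2 x :: "'a::comm_ring_1"
  shows "(a1 * of_nat j + a2) * pascal x j k + (b1 * of_nat (Suc j) + b2) * pascal x (Suc j) k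
    = (b1 * of_nat k + b2) * (if k = 0 then 0 else pascal x j (k - 1))
      + ((2 * x * b1 + a1) * of_nat k + a2 + x * (b1 + b2)) * pascal x j k
      + x * (a1 + x * b1) * of_nat (k + 1) * pascal x j (k + 1)"
proof -
  have "x * (a1 + x * b1) * of_nat (k + 1) * pascal x j (k + 1)
      = (a1 + x * b1) * (of_nat (Suc k) * (x * pascal x j (Suc k)))"
    by (simp add: mult_ac)
  then have up: "x * (a1 + x * b1) * of_nat (k + 1) * pascal x j (k + 1)
      = (a1 + x * b1) * ((of_nat j - of_nat k) * pascal x j k)"
    by (simp only: pascal_absorb)
  show ?thesis
  proof (cases k)
    case 0
    then show ?thesis unfolding up by (simp add: pascal_Suc_0 algebra_simps)
  next
    case (Suc l)
    \<comment> \<open>A second absorption, one column to the left, removes the factor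
      \<open>of_nat j\<close> from the term that Pascal's rule produces in column
      \<open>l\<close>.\<close>
    have "of_nat (Suc l) * (x * pascal x j (Suc l)) = (of_nat j - of_nat l) * pascal x j l"
      by (rule pascal_absorb)
    then have "b1 * (of_nat j * pascal x j l)
        = b1 * (of_nat l * pascal x j l + x * pascal x j (Suc l)
            + of_nat l * (x * pascal x j (Suc l)))"
      by (simp add: algebra_simps)
    then show ?thesis
      unfolding up using Suc by (simp add: pascal_Suc_Suc algebra_simps)
  qed
qed

lemma T_eq_times_pascal:
  fixes n k :: nat
  defines "S \<equiv> two_term_array (\<lambda>k. a1 * of_nat k + a2) (\<lambda>k. b1 * of_nat k + b2)"
  shows "T n k = (\<Sum>j\<le>n. S n j * pascal lam j k)"
proof (induction n arbitrary: k)
  case 0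
  then show ?case by (simp add: S_def pascal_def)
next
  case (Suc n)
  let ?P = "pascal lam"
  have if_sum: "(if k = 0 then 0 else \<Sum>j\<le>n. S n j * ?P j (k - 1))
      = (\<Sum>j\<le>n. S n j * (if k = 0 then 0 else ?P j (k - 1)))"
    by simp
  have "(\<Sum>j\<le>Suc n. S (Suc n) j * ?P j k)
      = (\<Sum>j\<le>Suc n. (a1 * of_nat j + a2) * S n j * ?P j k)
        + (\<Sum>j\<le>Suc n. if j = 0 then 0 else (b1 * of_nat j + b2) * S n (j - 1) * ?P j k)"
    unfolding sum.distrib[symmetric]
    by (intro sum.cong refl) (simp add: S_def algebra_simps)
  \<comment> \<open>The top term vanishes because \<open>S\<close> is lower triangular; the other
    sum is reindexed by \<open>Suc j\<close>, so both range over row \<open>n\<close> of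
    \<open>S\<close>.\<close>
  also have "(\<Sum>j\<le>Suc n. (a1 * of_nat j + a2) * S n j * ?P j k)
      = (\<Sum>j\<le>n. (a1 * of_nat j + a2) * S n j * ?P j k)"
    by (simp add: S_def two_term_array_eq_0)
  also have "(\<Sum>j\<le>Suc n. if j = 0 then 0 else (b1 * of_nat j + b2) * S n (j - 1) * ?P j k)
      = (\<Sum>j\<le>n. (b1 * of_nat (Suc j) + b2) * S n j * ?P (Suc j) k)"
    by (simp add: sum.atMost_Suc_shift del: sum.atMost_Suc of_nat_Suc)
  also have "(\<Sum>j\<le>n. (a1 * of_nat j + a2) * S n j * ?P j k)
        + (\<Sum>j\<le>n. (b1 * of_nat (Suc j) + b2) * S n j * ?P (Suc j) k)
      = (\<Sum>j\<le>n. S n j * ((a1 * of_nat j + a2) * ?P j k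
          + (b1 * of_nat (Suc j) + b2) * ?P (Suc j) k))"
    unfolding sum.distrib[symmetric] by (intro sum.cong refl) (simp add: algebra_simps)
  also have "\<dots> = (b1 * of_nat k + b2) * (if k = 0 then 0 else \<Sum>j\<le>n. S n j * ?P j (k - 1))
      + ((2 * lam * b1 + a1) * of_nat k + a2 + lam * (b1 + b2)) * (\<Sum>j\<le>n. S n j * ?P j k)
      + lam * (a1 + lam * b1) * of_nat (k + 1) * (\<Sum>j\<le>n. S n j * ?P j (k + 1))"
    unfolding if_sum sum_distrib_left sum.distrib[symmetric] pascal_intertwines
    by (intro sum.cong refl) (simp only: distrib_left mult.left_commute)
  also have "\<dots> = (b1 * of_nat k + b2) * (if k = 0 then 0 else T n (k - 1))
      + ((2 * lam * b1 + a1) * of_nat k + a2 + lam * (b1 + b2)) * T n k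
      + lam * (a1 + lam * b1) * of_nat (k + 1) * T n (k + 1)"
    by (simp only: Suc.IH)
  \<comment> \<open>For \<open>k > Suc n\<close>, where \<open>T\<close> is 0 by definition, all
    three terms vanish by triangularity.\<close>
  also have "\<dots> = T (Suc n) k"
    by (auto simp: T_eq_0)
  finally show ?case ..
qed

theorem theorem2p1:
  shows "coefficientwise_TP T"
proof -
  let ?S = "two_term_array (\<lambda>k. a1 * of_nat k + a2) (\<lambda>k. b1 * of_nat k + b2)"
  have "T = (\<lambda>n k. \<Sum>j\<le>n. ?S n j * pascal lam j k)"
    by (intro ext T_eq_times_pascal)
  moreover have "coefficientwise_TP (\<lambda>n k. \<Sum>j\<le>n. ?S n j * pascal lam j k)"
    by (intro coefficientwise_TP_times_pascal coefficientwise_TP_two_term_array)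
      (simp_all add: two_term_array_eq_0)
  ultimately show ?thesis by simp
qed

end
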